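(* Let $\mathscr H$ be a complex Hilbert space and let $\mathfrak M$ be a nonempty set of bounded self-adjoint operators on $\mathscr H$ that is bounded from below. Suppose that $\mathfrak M$ is countable and compact in the weak-operator topology. Then the infimum $\inf\mathfrak M$ exists if and only if there exists $G\in\mathfrak M$ such that $G\le A$ for all $A\in\mathfrak M$. In this case, $G=\inf\mathfrak M$.
   Context: $\mathfrak S$ denotes the real vector space of bounded self-adjoint operators on $\mathscr H$, with Löwner's order: $S\le T$ iff $(Su,u)\le (Tu,u)$ for all $u\in\mathscr H$. An operator $L\in\mathfrak S$ is a lower bound of $\mathfrak M\subseteq\mathfrak S$ if $L\le A$ for all $A\in\mathfrak M$; $\mathfrak M$ is bounded from below if it has at least one lower bound. The infimum $\inf\mathfrak M$ is the greatest element (if it exists) of the set of all lower bounds of $\mathfrak M$ in $\mathfrak S$, i.e. a lower bound $G$ with $L\le G$ for every lower bound $L$. The weak-operator topology is the coarsest topology on $\mathfrak S$ making all maps $S\mapsto (Su,v)$, $u,v\in\mathscr H$, continuous. Finite sets count as countable. *)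

theory Defs
  imports "HOL-Analysis.Analysis"
begin

class scaleC = scaleR +
  fixes scaleC :: "complex \<Rightarrow> 'a \<Rightarrow> 'a"  (infixr \<open>*\<^sub>C\<close> 75)
  assumes scaleR_scaleC: "scaleR r x = scaleC (complex_of_real r) x"

class complex_vector = scaleC + ab_group_add +
  assumes scaleC_add_right: "a *\<^sub>C (x + y) = a *\<^sub>C x + a *\<^sub>C y"
    and scaleC_add_left: "(a + b) *\<^sub>C x = a *\<^sub>C x + b *\<^sub>C x"
    and scaleC_scaleC: "a *\<^sub>C b *\<^sub>C x = (a * b) *\<^sub>C x"
    and scaleC_one: "1 *\<^sub>C x = x"

text \<open>The inner product is linear in its first and conjugate-linear in its second argument.\<close>

class complex_inner = complex_vector + real_normed_vector +
  fixes cinner :: "'a \<Rightarrow> 'a \<Rightarrow> complex"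
  assumes cinner_commute: "cinner x y = cnj (cinner y x)"
    and cinner_add_left: "cinner (x + y) z = cinner x z + cinner y z"
    and cinner_scaleC_left: "cinner (c *\<^sub>C x) y = c * cinner x y"
    and cinner_ge_zero: "0 \<le> Re (cinner x x)"
    and cinner_eq_zero_iff: "cinner x x = 0 \<longleftrightarrow> x = 0"
    and norm_eq_sqrt_cinner: "norm x = sqrt (Re (cinner x x))"

class complex_hilbert = complex_inner + complete_space

instantiation complex :: complex_hilbert
begin

definition scaleC_complex :: "complex \<Rightarrow> complex \<Rightarrow> complex"
  where "scaleC_complex c x = c * x"

definition cinner_complex :: "complex \<Rightarrow> complex \<Rightarrow> complex"
  where "cinner_complex x y = x * cnj y"

instance
proof
  fix x :: complex
  show "norm x = sqrt (Re (cinner x x))"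
    by (simp add: cinner_complex_def cmod_def power2_eq_square)
qed (auto simp: scaleC_complex_def cinner_complex_def algebra_simps scaleR_conv_of_real)

end

text \<open>The type of \<open>S\<close> only provides boundedness and real linearity, so complex homogeneity
  is required separately.\<close>

definition selfadjoint_ops :: "('a::complex_hilbert \<Rightarrow>\<^sub>L 'a) set" where
  "selfadjoint_ops = {S.
     (\<forall>c u. blinfun_apply S (c *\<^sub>C u) = c *\<^sub>C blinfun_apply S u) \<and>
     (\<forall>u v. cinner (blinfun_apply S u) v = cinner u (blinfun_apply S v))}"

lemma selfadjoint_ops_cinner_real:
  assumes "S \<in> selfadjoint_ops"
  shows "cinner (blinfun_apply S u) u \<in> \<real>"
proof -
  have "cinner (blinfun_apply S u) u = cnj (cinner (blinfun_apply S u) u)"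
    using assms cinner_commute[of u "blinfun_apply S u"] by (simp add: selfadjoint_ops_def)
  then show ?thesis
    by (metis Reals_cnj_iff)
qed

text \<open>Loewner's order; it is only used on \<open>selfadjoint_ops\<close>, where both inner products are
  real by the preceding lemma, so taking real parts loses nothing.\<close>

definition loewner_le :: "('a::complex_hilbert \<Rightarrow>\<^sub>L 'a) \<Rightarrow> ('a \<Rightarrow>\<^sub>L 'a) \<Rightarrow> bool"
    (infix \<open>\<preceq>\<close> 50) where
  "S \<preceq> T \<longleftrightarrow>
     (\<forall>u. Re (cinner (blinfun_apply S u) u) \<le> Re (cinner (blinfun_apply T u) u))"

definition loewner_lower_bounds ::
    "('a::complex_hilbert \<Rightarrow>\<^sub>L 'a) set \<Rightarrow> ('a \<Rightarrow>\<^sub>L 'a) set" where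
  "loewner_lower_bounds M = {L \<in> selfadjoint_ops. \<forall>A\<in>M. L \<preceq> A}"

definition loewner_bdd_below :: "('a::complex_hilbert \<Rightarrow>\<^sub>L 'a) set \<Rightarrow> bool" where
  "loewner_bdd_below M \<longleftrightarrow> loewner_lower_bounds M \<noteq> {}"

definition is_loewner_Inf ::
    "('a::complex_hilbert \<Rightarrow>\<^sub>L 'a) set \<Rightarrow> ('a \<Rightarrow>\<^sub>L 'a) \<Rightarrow> bool" where
  "is_loewner_Inf M G \<longleftrightarrow>
     G \<in> loewner_lower_bounds M \<and> (\<forall>L\<in>loewner_lower_bounds M. L \<preceq> G)"

text \<open>Meaningful only if an infimum exists; it is then unique by antisymmetry of \<open>\<preceq>\<close>.\<close>

definition loewner_Inf :: "('a::complex_hilbert \<Rightarrow>\<^sub>L 'a) set \<Rightarrow> ('a \<Rightarrow>\<^sub>L 'a)" where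
  "loewner_Inf M = (THE G. is_loewner_Inf M G)"

text \<open>The preimages of open sets under the maps \<open>S \<mapsto> (S u, v)\<close> form a subbasis of the coarsest
  topology on \<open>selfadjoint_ops\<close> that makes all these maps continuous.\<close>

definition weak_operator_topology :: "('a::complex_hilbert \<Rightarrow>\<^sub>L 'a) topology" where
  "weak_operator_topology = topology_generated_by
     {{S \<in> selfadjoint_ops. cinner (blinfun_apply S u) v \<in> U} | u v U. open U}"

lemma topspace_weak_operator_topology:
  "topspace weak_operator_topology = (selfadjoint_ops :: ('a::complex_hilbert \<Rightarrow>\<^sub>L 'a) set)"
  unfolding weak_operator_topology_def topology_generated_by_topspace
  by (auto intro!: exI[of _ UNIV])

end

theory Submission
  imports Defs
begin

text \<open>
  A least element of \<open>M\<close> is trivially its infimum, so the content is that an infimum \<open>H\<close> of \<open>M\<close>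
  must belong to \<open>M\<close> (\<open>loewner_Inf_mem\<close>). The reason is that if \<open>H \<notin> M\<close>, then \<open>H\<close> can be tilted:
  raised in one direction \<open>u\<close> and pushed down on the orthogonal complement of \<open>u\<close>, without
  ceasing to be a lower bound.

  For \<open>A \<in> M\<close> put \<open>q A v = ((A - H) v, v)\<close>, a nonnegative quadratic form that is not
  identically zero when \<open>A \<noteq> H\<close>. Its zero set is then a proper closed subspace, hence
  nowhere dense. As \<open>M\<close> is countable, Baire's theorem yields a unit vector \<open>u\<close> with \<open>q A u > 0\<close>
  for every \<open>A \<in> M\<close> (\<open>countable_psd_forms_common_positive\<close>). The map \<open>A \<mapsto> q A u\<close> is continuous in
  the weak-operator topology, so by compactness it attains a minimum \<open>c > 0\<close> on \<open>M\<close>. In the same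
  way \<open>A \<mapsto> q A v\<close> is bounded on \<open>M\<close> for each \<open>v\<close>, and a second use of Baire's theorem, the uniform
  boundedness principle for forms, gives \<open>C\<close> with \<open>q A v \<le> C * (norm v)\<^sup>2\<close> for all \<open>A \<in> M\<close>
  and all \<open>v\<close> (\<open>psd_forms_pointwise_bounded_imp_uniformly_bounded\<close>).

  Let \<open>P\<close> be the orthogonal projection onto the line spanned by \<open>u\<close>. The two bounds imply that
  \<open>L = H + (c / 2) P - C (1 - P)\<close> still lies below every \<open>A \<in> M\<close> (\<open>op_form_ge_tilted\<close>), although
  \<open>(L u, u) = (H u, u) + c / 2\<close>. So \<open>L\<close> is a lower bound of \<open>M\<close> that is not below \<open>H\<close>, which
  contradicts the choice of \<open>H\<close>.
\<close>

section \<open>Inner product identities\<close>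

lemma cinner_scaleR_left: "cinner (r *\<^sub>R x) y = complex_of_real r * cinner x y"
  for x :: "'a::complex_inner"
  by (simp add: scaleR_scaleC cinner_scaleC_left)

lemma cinner_add_right: "cinner z (x + y) = cinner z x + cinner z y"
  for x :: "'a::complex_inner"
  by (metis cinner_add_left cinner_commute complex_cnj_add)

lemma cinner_scaleC_right: "cinner y (c *\<^sub>C x) = cnj c * cinner y x"
  for x :: "'a::complex_inner"
  by (metis cinner_scaleC_left cinner_commute complex_cnj_mult)

lemma cinner_scaleR_right: "cinner y (r *\<^sub>R x) = complex_of_real r * cinner y x"
  for x :: "'a::complex_inner"
  by (simp add: scaleR_scaleC cinner_scaleC_right)

lemma cinner_minus_left: "cinner (- x) y = - cinner x y"
  for x :: "'a::complex_inner"
  using cinner_scaleR_left[of "-1" x y] by simp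

lemma cinner_minus_right: "cinner y (- x) = - cinner y x"
  for x :: "'a::complex_inner"
  using cinner_scaleR_right[of y "-1" x] by simp

lemma cinner_diff_left: "cinner (x - y) z = cinner x z - cinner y z"
  for x :: "'a::complex_inner"
  using cinner_add_left[of x "- y" z] by (simp add: cinner_minus_left)

lemma cinner_diff_right: "cinner z (x - y) = cinner z x - cinner z y"
  for x :: "'a::complex_inner"
  using cinner_add_right[of z x "- y"] by (simp add: cinner_minus_right)

lemma Re_cinner_commute: "Re (cinner x y) = Re (cinner y x)"
  for x :: "'a::complex_inner"
  by (metis cinner_commute cnj.simps(1))

lemma Re_cinner_self: "Re (cinner x x) = (norm x)\<^sup>2"
  for x :: "'a::complex_inner"
  by (simp add: norm_eq_sqrt_cinner cinner_ge_zero)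

lemma cinner_self: "cinner x x = complex_of_real ((norm x)\<^sup>2)"
  for x :: "'a::complex_inner"
proof -
  have "cinner x x \<in> \<real>"
    by (metis Reals_cnj_iff cinner_commute)
  then show ?thesis
    by (metis Re_cinner_self of_real_Re)
qed

text \<open>Expressing the inner product through the norm makes its continuity immediate.\<close>

lemma Re_cinner_polarization:
  "Re (cinner x y) = ((norm (x + y))\<^sup>2 - (norm (x - y))\<^sup>2) / 4"
  for x :: "'a::complex_inner"
  using Re_cinner_commute[of x y]
  by (simp flip: Re_cinner_self
        add: cinner_add_left cinner_add_right cinner_diff_left cinner_diff_right)

lemma norm_scaleC: "norm (c *\<^sub>C x) = cmod c * norm x"
  for x :: "'a::complex_inner"
proof -
  have "cinner (c *\<^sub>C x) (c *\<^sub>C x) = c * cnj c * cinner x x"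
    by (simp add: cinner_scaleC_left cinner_scaleC_right)
  also have "\<dots> = complex_of_real ((cmod c * norm x)\<^sup>2)"
    by (metis complex_norm_square cinner_self of_real_mult power_mult_distrib)
  finally have "(norm (c *\<^sub>C x))\<^sup>2 = (cmod c * norm x)\<^sup>2"
    by (metis Re_cinner_self Re_complex_of_real)
  then show ?thesis
    by (simp add: power2_eq_iff_nonneg)
qed

lemma norm_minus_projection:
  fixes u v :: "'a::complex_inner"
  assumes "norm u = 1"
  shows "(norm (v - cinner v u *\<^sub>C u))\<^sup>2 = (norm v)\<^sup>2 - (cmod (cinner v u))\<^sup>2"
proof -
  have uu: "cinner u u = 1"
    using assms by (simp add: cinner_self)
  have uv: "cinner u v = cnj (cinner v u)"
    by (rule cinner_commute)
  have "cinner (v - cinner v u *\<^sub>C u) (v - cinner v u *\<^sub>C u)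
      = cinner v v - cinner v u * cnj (cinner v u)"
    by (simp add: cinner_diff_left cinner_diff_right cinner_scaleC_left cinner_scaleC_right uu uv
          algebra_simps)
  also have "\<dots> = complex_of_real ((norm v)\<^sup>2 - (cmod (cinner v u))\<^sup>2)"
    by (metis cinner_self complex_norm_square of_real_diff)
  finally show ?thesis
    by (metis Re_cinner_self Re_complex_of_real)
qed

lemma norm_cinner_unit_le:
  fixes u v :: "'a::complex_inner"
  assumes "norm u = 1"
  shows "cmod (cinner v u) \<le> norm v"
proof -
  have "(cmod (cinner v u))\<^sup>2 \<le> (norm v)\<^sup>2"
    using norm_minus_projection[OF assms, of v]
      zero_le_power2[of "norm (v - cinner v u *\<^sub>C u)"] by linarith
  then show ?thesis
    using norm_ge_zero power2_le_imp_le by blast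
qed

section \<open>Positive quadratic forms and the Baire category theorem\<close>

text \<open>
  The properties of a nonnegative quadratic form on which both applications of Baire's theorem
  rest. The inequality for \<open>q (x + y)\<close> is what remains of the parallelogram law after dropping
  the term \<open>q (x - y)\<close>.
\<close>

definition psd_form :: "('a::real_normed_vector \<Rightarrow> real) \<Rightarrow> bool" where
  "psd_form q \<longleftrightarrow> continuous_on UNIV q \<and> (\<forall>x. 0 \<le> q x) \<and>
     (\<forall>x y. q (x + y) \<le> 2 * q x + 2 * q y) \<and> (\<forall>r x. q (r *\<^sub>R x) = r\<^sup>2 * q x)"

text \<open>
  A bound on a ball with arbitrary centre \<open>z\<close> becomes a bound on the ball around the origin of the
  same radius, by writing \<open>y = (z + y) + (- z)\<close>; homogeneity then extends it to the whole space.
  With \<open>n = 0\<close> this says that a form vanishing on some ball vanishes everywhere.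
\<close>

lemma psd_form_le_of_le_on_ball:
  fixes q :: "'a::real_normed_vector \<Rightarrow> real"
  assumes q: "psd_form q" and r: "r > 0" and le: "\<And>x. x \<in> ball z r \<Longrightarrow> q x \<le> n"
  shows "q x \<le> 16 * n / r\<^sup>2 * (norm x)\<^sup>2"
proof (cases "x = 0")
  case True
  have "q (0 *\<^sub>R x) = 0\<^sup>2 * q x"
    using q unfolding psd_form_def by blast
  with True show ?thesis
    by simp
next
  case False
  \<comment> \<open>This scaling gives \<open>t *\<^sub>R x\<close> the norm \<open>r / 2\<close>, strictly less than the radius of the open ball.\<close>
  define t where "t = r / (2 * norm x)"
  have t: "t > 0"
    using False r by (simp add: t_def)
  have "norm (t *\<^sub>R x) = r / 2"
    using False r by (simp add: t_def)
  then have "z + t *\<^sub>R x \<in> ball z r"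
    using r by (simp add: dist_norm)
  then have 1: "q (z + t *\<^sub>R x) \<le> n"
    by (rule le)
  have "q ((-1) *\<^sub>R z) = (-1)\<^sup>2 * q z"
    using q unfolding psd_form_def by blast
  then have 2: "q (- z) \<le> n"
    using le[of z] r by simp
  have "q ((z + t *\<^sub>R x) + (- z)) \<le> 2 * q (z + t *\<^sub>R x) + 2 * q (- z)"
    using q unfolding psd_form_def by blast
  then have "q (t *\<^sub>R x) \<le> 4 * n"
    using 1 2 by simp
  moreover have "q (t *\<^sub>R x) = t\<^sup>2 * q x"
    using q unfolding psd_form_def by blast
  ultimately have "q x \<le> 4 * n / t\<^sup>2"
    using t by (simp add: field_simps)
  also have "\<dots> = 16 * n / r\<^sup>2 * (norm x)\<^sup>2"
    by (simp add: t_def field_simps power2_eq_square)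
  finally show ?thesis .
qed

lemma countable_closed_cover_has_ball:
  fixes F :: "'i \<Rightarrow> 'a::complete_space set"
  assumes "countable I" and closed: "\<And>i. i \<in> I \<Longrightarrow> closed (F i)"
    and cover: "\<And>x. \<exists>i\<in>I. x \<in> F i"
  shows "\<exists>i\<in>I. \<exists>z r. r > 0 \<and> ball z r \<subseteq> F i"
proof -
  have "\<exists>i\<in>I. interior (F i) \<noteq> {}"
  proof (rule ccontr)
    assume neg: "\<not> (\<exists>i\<in>I. interior (F i) \<noteq> {})"
    have "Met_TC.mtopology interior_of \<Union>(F ` I) = {}"
    proof (rule Met_TC.metric_Baire_category_alt)
      show "Met_TC.mcomplete TYPE('a)"
        using complete_UNIV by simp
      show "countable (F ` I)"
        using \<open>countable I\<close> by simp
      show "closedin Met_TC.mtopology T \<and> Met_TC.mtopology interior_of T = {}"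
        if "T \<in> F ` I" for T
        using that closed neg by auto
    qed
    moreover have "\<Union>(F ` I) = UNIV"
      using cover by blast
    ultimately show False
      by simp
  qed
  then show ?thesis
    by (metis equals0I mem_interior)
qed

text \<open>
  The uniform boundedness principle for forms: the sets on which all forms of the family are at
  most \<open>n\<close> are closed and cover the space, so one of them contains a ball.
\<close>

lemma psd_forms_pointwise_bounded_imp_uniformly_bounded:
  fixes q :: "'i \<Rightarrow> 'a::{real_normed_vector,complete_space} \<Rightarrow> real"
  assumes psd: "\<And>i. i \<in> I \<Longrightarrow> psd_form (q i)"
    and bdd: "\<And>x. \<exists>b. \<forall>i\<in>I. q i x \<le> b"
  shows "\<exists>C. \<forall>i\<in>I. \<forall>x. q i x \<le> C * (norm x)\<^sup>2"
proof -
  define T where "T n = (\<Inter>i\<in>I. {x. q i x \<le> real n})" for n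
  have "closed (T n)" for n
    unfolding T_def
    by (intro closed_INT ballI closed_Collect_le continuous_on_const)
      (use psd in \<open>auto simp: psd_form_def\<close>)
  moreover have "\<exists>n\<in>UNIV. x \<in> T n" for x
  proof -
    obtain b where "\<forall>i\<in>I. q i x \<le> b"
      using bdd by blast
    moreover obtain n where "b \<le> real n"
      using real_arch_simple by blast
    ultimately show ?thesis
      unfolding T_def using order_trans by blast
  qed
  ultimately obtain n z r where r: "r > 0" and "ball z r \<subseteq> T n"
    using countable_closed_cover_has_ball[of UNIV T] by auto
  then have "q i x \<le> 16 * real n / r\<^sup>2 * (norm x)\<^sup>2" if "i \<in> I" for i x
    by (intro psd_form_le_of_le_on_ball[OF psd[OF that] r]) (use that T_def in auto)
  then show ?thesis
    by blast
qed

text \<open>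
  If every vector were a zero of some form, the countably many closed zero sets would cover the
  space; one of them would contain a ball, which forces the corresponding form to be zero.
  As the forms are nonnegative, their zero sets are written as sublevel sets.
\<close>

lemma countable_psd_forms_common_positive:
  fixes q :: "'i \<Rightarrow> 'a::{real_normed_vector,complete_space} \<Rightarrow> real"
  assumes "countable I" and psd: "\<And>i. i \<in> I \<Longrightarrow> psd_form (q i)"
    and nonzero: "\<And>i. i \<in> I \<Longrightarrow> \<exists>x. q i x \<noteq> 0"
  shows "\<exists>u. \<forall>i\<in>I. q i u > 0"
proof (rule ccontr)
  assume "\<not> (\<exists>u. \<forall>i\<in>I. q i u > 0)"
  then have "\<exists>i\<in>I. u \<in> {x. q i x \<le> 0}" for u
    by (auto simp: not_less)
  moreover have "closed {x. q i x \<le> 0}" if "i \<in> I" for i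
    using psd[OF that] by (intro closed_Collect_le continuous_on_const) (simp add: psd_form_def)
  ultimately obtain i z r where i: "i \<in> I" and r: "r > 0" and "ball z r \<subseteq> {x. q i x \<le> 0}"
    using countable_closed_cover_has_ball[of I "\<lambda>i. {x. q i x \<le> 0}"] \<open>countable I\<close> by blast
  then have "q i x \<le> 16 * 0 / r\<^sup>2 * (norm x)\<^sup>2" for x
    by (intro psd_form_le_of_le_on_ball[OF psd[OF i] r]) auto
  moreover have "0 \<le> q i x" for x
    using psd[OF i] by (simp add: psd_form_def)
  ultimately show False
    using nonzero[OF i] by (auto simp: order_antisym)
qed

section \<open>Self-adjoint operators and their quadratic forms\<close>

definition op_form :: "('a::complex_hilbert \<Rightarrow>\<^sub>L 'a) \<Rightarrow> 'a \<Rightarrow> real" where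
  "op_form S u = Re (cinner (blinfun_apply S u) u)"

lemma loewner_le_iff: "S \<preceq> T \<longleftrightarrow> (\<forall>u. op_form S u \<le> op_form T u)"
  by (simp add: loewner_le_def op_form_def)

lemma op_form_add: "op_form (S + T) u = op_form S u + op_form T u"
  by (simp add: op_form_def blinfun.add_left cinner_add_left)

lemma op_form_diff: "op_form (S - T) u = op_form S u - op_form T u"
  by (simp add: op_form_def blinfun.diff_left cinner_diff_left)

lemma op_form_scaleR: "op_form (r *\<^sub>R S) u = r * op_form S u"
  by (simp add: op_form_def blinfun.scaleR_left cinner_scaleR_left)

lemma op_form_id: "op_form id_blinfun u = (norm u)\<^sup>2"
  by (simp add: op_form_def Re_cinner_self)

lemma selfadjoint_ops_add:
  "S \<in> selfadjoint_ops \<Longrightarrow> T \<in> selfadjoint_ops \<Longrightarrow> S + T \<in> selfadjoint_ops"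
  by (simp add: selfadjoint_ops_def blinfun.add_left cinner_add_left cinner_add_right
        scaleC_add_right)

lemma selfadjoint_ops_scaleR: "S \<in> selfadjoint_ops \<Longrightarrow> r *\<^sub>R S \<in> selfadjoint_ops"
  by (simp add: selfadjoint_ops_def blinfun.scaleR_left cinner_scaleR_left cinner_scaleR_right)
    (simp add: scaleR_scaleC scaleC_scaleC mult.commute)

lemma selfadjoint_ops_diff:
  "S \<in> selfadjoint_ops \<Longrightarrow> T \<in> selfadjoint_ops \<Longrightarrow> S - T \<in> selfadjoint_ops"
  using selfadjoint_ops_add[OF _ selfadjoint_ops_scaleR[of T "-1"], of S] by simp

lemma selfadjoint_ops_id: "id_blinfun \<in> selfadjoint_ops"
  by (simp add: selfadjoint_ops_def)

lemma op_form_scaleC: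
  assumes "S \<in> selfadjoint_ops"
  shows "op_form S (c *\<^sub>C u) = (cmod c)\<^sup>2 * op_form S u"
proof -
  have "cinner (blinfun_apply S (c *\<^sub>C u)) (c *\<^sub>C u)
      = c * cnj c * cinner (blinfun_apply S u) u"
    using assms by (simp add: selfadjoint_ops_def cinner_scaleC_left cinner_scaleC_right)
  also have "\<dots> = complex_of_real ((cmod c)\<^sup>2) * cinner (blinfun_apply S u) u"
    by (metis complex_norm_square)
  finally show ?thesis
    unfolding op_form_def by simp
qed

lemma op_form_plus:
  assumes "S \<in> selfadjoint_ops"
  shows "op_form S (x + y) = op_form S x + op_form S y + 2 * Re (cinner (blinfun_apply S x) y)"
proof -
  have "Re (cinner (blinfun_apply S y) x) = Re (cinner (blinfun_apply S x) y)"
    using assms Re_cinner_commute[of "blinfun_apply S x" y] by (simp add: selfadjoint_ops_def)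
  then show ?thesis
    by (simp add: op_form_def blinfun.add_right cinner_add_left cinner_add_right)
qed

lemma psd_form_op_form:
  assumes S: "S \<in> selfadjoint_ops" and pos: "\<And>x. 0 \<le> op_form S x"
  shows "psd_form (op_form S)"
  unfolding psd_form_def
proof (intro conjI allI)
  show "continuous_on UNIV (op_form S)"
    unfolding op_form_def Re_cinner_polarization by (intro continuous_intros) auto
  show "0 \<le> op_form S x" for x
    by (rule pos)
  show scale: "op_form S (r *\<^sub>R x) = r\<^sup>2 * op_form S x" for r x
    using op_form_scaleC[OF S, of "complex_of_real r" x] by (simp add: scaleR_scaleC)
  show "op_form S (x + y) \<le> 2 * op_form S x + 2 * op_form S y" for x y
  proof -
    have "op_form S (x + (-1) *\<^sub>R y) =
        op_form S x + op_form S y - 2 * Re (cinner (blinfun_apply S x) y)"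
      unfolding op_form_plus[OF S] scale by (simp add: cinner_minus_right)
    then show ?thesis
      using op_form_plus[OF S, of x y] pos[of "x + (-1) *\<^sub>R y"] by linarith
  qed
qed

text \<open>
  If the form of the self-adjoint \<open>D = S - T\<close> vanishes, then its expansion at \<open>x + y\<close> leaves
  \<open>Re (D x, y) = 0\<close>, and \<open>y = D x\<close> gives \<open>D x = 0\<close>.
\<close>

lemma selfadjoint_op_form_eq_imp_eq:
  assumes S: "S \<in> selfadjoint_ops" and T: "T \<in> selfadjoint_ops"
    and eq: "\<And>x. op_form S x = op_form T x"
  shows "S = T"
proof -
  have D: "S - T \<in> selfadjoint_ops"
    by (rule selfadjoint_ops_diff[OF S T])
  have "op_form (S - T) x = 0" for x
    by (simp add: op_form_diff eq)
  then have "Re (cinner (blinfun_apply (S - T) x) y) = 0" for x y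
    using op_form_plus[OF D, of x y] by simp
  then have "blinfun_apply (S - T) x = 0" for x
    using Re_cinner_self[of "blinfun_apply (S - T) x"] by simp
  then show ?thesis
    by (intro blinfun_eqI) (simp add: blinfun.diff_left)
qed

lemma loewner_antisym:
  "S \<in> selfadjoint_ops \<Longrightarrow> T \<in> selfadjoint_ops \<Longrightarrow> S \<preceq> T \<Longrightarrow> T \<preceq> S \<Longrightarrow> S = T"
  by (rule selfadjoint_op_form_eq_imp_eq) (auto simp: loewner_le_iff order_antisym)

lemma unit_projection:
  fixes u :: "'a::complex_hilbert"
  assumes u: "norm u = 1"
  obtains P where "P \<in> selfadjoint_ops" "\<And>v. op_form P v = (cmod (cinner v u))\<^sup>2"
proof -
  have "bounded_linear (\<lambda>v. cinner v u *\<^sub>C u)"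
  proof (rule bounded_linear_intro)
    show "norm (cinner v u *\<^sub>C u) \<le> norm v * 1" for v
      using norm_cinner_unit_le[OF u, of v] u by (simp add: norm_scaleC)
  qed (simp_all add: cinner_add_left scaleC_add_left scaleR_scaleC cinner_scaleC_left scaleC_scaleC)
  then have P: "blinfun_apply (Blinfun (\<lambda>v. cinner v u *\<^sub>C u)) = (\<lambda>v. cinner v u *\<^sub>C u)"
    by (rule bounded_linear_Blinfun_apply)
  show thesis
  proof
    show "Blinfun (\<lambda>v. cinner v u *\<^sub>C u) \<in> selfadjoint_ops"
      by (simp add: selfadjoint_ops_def P cinner_scaleC_left cinner_scaleC_right scaleC_scaleC)
        (metis cinner_commute mult.commute)
    have "cinner v u * cinner u v = complex_of_real ((cmod (cinner v u))\<^sup>2)" for v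
      using cinner_commute[of u v] by (metis complex_norm_square)
    then show "op_form (Blinfun (\<lambda>v. cinner v u *\<^sub>C u)) v = (cmod (cinner v u))\<^sup>2" for v
      unfolding op_form_def P by (simp add: cinner_scaleC_left del: of_real_power)
  qed
qed

text \<open>
  Weak-operator compactness enters through this fact: over a compact set of operators, each form
  value \<open>(S u, u)\<close> attains its minimum and its maximum.
\<close>

lemma compact_op_form_image:
  assumes "compactin weak_operator_topology M"
  shows "compact ((\<lambda>S. op_form S u) ` M)"
proof -
  have "continuous_map weak_operator_topology euclidean (\<lambda>S. cinner (blinfun_apply S u) u)"
    unfolding continuous_map_alt topspace_weak_operator_topology
  proof (intro conjI allI impI)
    fix U :: "complex set"
    assume "openin euclidean U"
    then have "{S \<in> selfadjoint_ops. cinner (blinfun_apply S u) u \<in> U} \<in>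
        {{S \<in> selfadjoint_ops. cinner (blinfun_apply S u) v \<in> U} | u v U. open U}"
      by auto
    then have "openin weak_operator_topology
        {S \<in> selfadjoint_ops. cinner (blinfun_apply S u) u \<in> U}"
      unfolding weak_operator_topology_def by (rule topology_generated_by_Basis)
    also have "{S \<in> selfadjoint_ops. cinner (blinfun_apply S u) u \<in> U} =
        (\<lambda>S. cinner (blinfun_apply S u) u) -` U \<inter> selfadjoint_ops"
      by auto
    finally show "openin weak_operator_topology
        ((\<lambda>S. cinner (blinfun_apply S u) u) -` U \<inter> selfadjoint_ops)" .
  qed auto
  then have "compact ((\<lambda>S. cinner (blinfun_apply S u) u) ` M)"
    using image_compactin[OF assms] by fastforce
  then have "compact (Re ` (\<lambda>S. cinner (blinfun_apply S u) u) ` M)"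
    by (intro compact_continuous_image[of _ Re] continuous_intros)
  then show ?thesis
    by (simp add: image_image op_form_def)
qed

section \<open>The infimum of a countable weakly compact set\<close>

text \<open>
  The left-hand side is the form of \<open>(c / 2) P - C (1 - P)\<close>, where \<open>P\<close> projects onto the line
  spanned by \<open>u\<close>. Split \<open>v = s u + w\<close> with \<open>s = (v, u)\<close> and \<open>w\<close> orthogonal to \<open>u\<close>. The cross terms
  between \<open>s u\<close> and \<open>w\<close> are absorbed by applying the parallelogram inequality to \<open>s u = v - w\<close>:
  the form at \<open>s u\<close>, at least \<open>c \<bar>s\<bar>\<^sup>2\<close>, is at most twice the form at \<open>v\<close> plus twice the form at \<open>w\<close>,
  and the latter is controlled by \<open>C\<close>. Halving this costs the factor in \<open>c / 2\<close>.
\<close>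

lemma op_form_ge_tilted:
  fixes u v :: "'a::complex_hilbert"
  assumes S: "S \<in> selfadjoint_ops" and pos: "\<And>x. 0 \<le> op_form S x"
    and u: "norm u = 1" and c: "c \<le> op_form S u"
    and C: "\<And>x. op_form S x \<le> C * (norm x)\<^sup>2"
  shows "(c / 2 + C) * (cmod (cinner v u))\<^sup>2 - C * (norm v)\<^sup>2 \<le> op_form S v"
proof -
  define s where "s = cinner v u"
  define w where "w = v - s *\<^sub>C u"
  have su: "s *\<^sub>C u = v + (-1) *\<^sub>R w"
    by (simp add: w_def)
  have psd: "psd_form (op_form S)"
    by (rule psd_form_op_form[OF S pos])
  have "(cmod s)\<^sup>2 * c \<le> (cmod s)\<^sup>2 * op_form S u"
    by (intro mult_left_mono c) simp
  also have "\<dots> = op_form S (v + (-1) *\<^sub>R w)"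
    unfolding su[symmetric] by (rule op_form_scaleC[OF S, symmetric])
  also have "\<dots> \<le> 2 * op_form S v + 2 * op_form S ((-1) *\<^sub>R w)"
    using psd unfolding psd_form_def by blast
  also have "op_form S ((-1) *\<^sub>R w) = (-1)\<^sup>2 * op_form S w"
    using psd unfolding psd_form_def by blast
  also have "\<dots> = op_form S w"
    by simp
  also have "op_form S w \<le> C * ((norm v)\<^sup>2 - (cmod s)\<^sup>2)"
    using C[of w] norm_minus_projection[OF u, of v] by (simp add: w_def s_def)
  finally show ?thesis
    by (simp add: s_def algebra_simps)
qed

text \<open>
  If \<open>H\<close> were outside \<open>M\<close>, the tilted operator of the preceding lemma, added to \<open>H\<close>, would be a
  lower bound of \<open>M\<close> exceeding \<open>H\<close> in the direction \<open>u\<close>.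
\<close>

lemma loewner_Inf_mem:
  fixes M :: "('a::complex_hilbert \<Rightarrow>\<^sub>L 'a) set"
  assumes sa: "M \<subseteq> selfadjoint_ops" and "M \<noteq> {}" and "countable M"
    and compact: "compactin weak_operator_topology M"
    and inf: "is_loewner_Inf M H"
  shows "H \<in> M"
proof (rule ccontr)
  assume "H \<notin> M"
  have H: "H \<in> selfadjoint_ops" and lower: "\<And>A. A \<in> M \<Longrightarrow> H \<preceq> A"
    using inf by (auto simp: is_loewner_Inf_def loewner_lower_bounds_def)
  have D: "A - H \<in> selfadjoint_ops" if "A \<in> M" for A
    using that sa H by (auto intro: selfadjoint_ops_diff)
  have pos: "0 \<le> op_form (A - H) x" if "A \<in> M" for A x
    using lower[OF that] by (simp add: loewner_le_iff op_form_diff)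
  have psd: "psd_form (op_form (A - H))" if "A \<in> M" for A
    by (rule psd_form_op_form[OF D[OF that] pos[OF that]])
  have nonzero: "\<exists>x. op_form (A - H) x \<noteq> 0" if "A \<in> M" for A
    using selfadjoint_op_form_eq_imp_eq[of A H] that sa H \<open>H \<notin> M\<close>
    by (auto simp: op_form_diff)
  obtain u0 where u0: "\<And>A. A \<in> M \<Longrightarrow> op_form (A - H) u0 > 0"
    using countable_psd_forms_common_positive[of M "\<lambda>A. op_form (A - H)", OF \<open>countable M\<close> psd nonzero]
    by blast
  have "op_form (A - H) 0 = 0" for A
    by (simp add: op_form_def cinner_self)
  then have "u0 \<noteq> 0"
    using u0 \<open>M \<noteq> {}\<close> by fastforce
  define u where "u = (1 / norm u0) *\<^sub>R u0"
  have u: "norm u = 1"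
    using \<open>u0 \<noteq> 0\<close> by (simp add: u_def)
  have u_pos: "op_form (A - H) u > 0" if "A \<in> M" for A
  proof -
    have "op_form (A - H) u = (1 / norm u0)\<^sup>2 * op_form (A - H) u0"
      unfolding u_def using psd[OF that] unfolding psd_form_def by blast
    then show ?thesis
      using u0[OF that] \<open>u0 \<noteq> 0\<close> by simp
  qed
  obtain A0 where A0: "A0 \<in> M" "\<And>A. A \<in> M \<Longrightarrow> op_form A0 u \<le> op_form A u"
    using compact_attains_inf[OF compact_op_form_image[OF compact, of u]] \<open>M \<noteq> {}\<close> by auto
  define c where "c = op_form (A0 - H) u"
  have "c > 0"
    unfolding c_def by (rule u_pos[OF A0(1)])
  have c: "c \<le> op_form (A - H) u" if "A \<in> M" for A
    using A0(2)[OF that] by (simp add: c_def op_form_diff)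
  have bdd: "\<exists>b. \<forall>A\<in>M. op_form (A - H) x \<le> b" for x
  proof -
    obtain A1 where "\<And>A. A \<in> M \<Longrightarrow> op_form A x \<le> op_form A1 x"
      using compact_attains_sup[OF compact_op_form_image[OF compact, of x]] \<open>M \<noteq> {}\<close> by auto
    then show ?thesis
      by (intro exI[of _ "op_form A1 x - op_form H x"]) (simp add: op_form_diff)
  qed
  then obtain C where C: "\<And>A x. A \<in> M \<Longrightarrow> op_form (A - H) x \<le> C * (norm x)\<^sup>2"
    using psd_forms_pointwise_bounded_imp_uniformly_bounded[of M "\<lambda>A. op_form (A - H)", OF psd bdd]
    by blast
  obtain P where P: "P \<in> selfadjoint_ops" "\<And>v. op_form P v = (cmod (cinner v u))\<^sup>2"
    using unit_projection[OF u] by blast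
  define L where "L = H + ((c / 2 + C) *\<^sub>R P - C *\<^sub>R id_blinfun)"
  have L_form: "op_form L v =
      op_form H v + ((c / 2 + C) * (cmod (cinner v u))\<^sup>2 - C * (norm v)\<^sup>2)" for v
    by (simp add: L_def op_form_add op_form_diff op_form_scaleR op_form_id P(2))
  have "L \<in> selfadjoint_ops"
    unfolding L_def
    by (intro selfadjoint_ops_add selfadjoint_ops_diff selfadjoint_ops_scaleR H P(1)
        selfadjoint_ops_id)
  moreover have "L \<preceq> A" if "A \<in> M" for A
    unfolding loewner_le_iff L_form
    using op_form_ge_tilted[OF D[OF that] pos[OF that] u c[OF that] C[OF that]]
    by (simp add: op_form_diff algebra_simps)
  ultimately have "L \<preceq> H"
    using inf by (auto simp: is_loewner_Inf_def loewner_lower_bounds_def)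
  moreover have "op_form L u = op_form H u + c / 2"
    using u by (simp add: L_form cinner_self)
  ultimately show False
    using \<open>c > 0\<close> by (auto simp: loewner_le_iff dest: spec[of _ u])
qed

lemma is_loewner_Inf_unique:
  assumes "is_loewner_Inf M G" and "is_loewner_Inf M H"
  shows "G = H"
  using assms
  by (intro loewner_antisym) (auto simp: is_loewner_Inf_def loewner_lower_bounds_def)

theorem corollary3p4:
  fixes M :: "('a::complex_hilbert \<Rightarrow>\<^sub>L 'a) set"
  assumes "M \<subseteq> selfadjoint_ops"
    and "M \<noteq> {}"
    and "loewner_bdd_below M"
    and "countable M"
    and "compactin weak_operator_topology M"
  shows "((\<exists>H. is_loewner_Inf M H) \<longleftrightarrow> (\<exists>G\<in>M. \<forall>A\<in>M. G \<preceq> A)) \<and>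
         (\<forall>G\<in>M. (\<forall>A\<in>M. G \<preceq> A) \<longrightarrow> is_loewner_Inf M G \<and> G = loewner_Inf M)"
proof -
  have least: "is_loewner_Inf M G" if "G \<in> M" "\<forall>A\<in>M. G \<preceq> A" for G
    using that assms(1) by (auto simp: is_loewner_Inf_def loewner_lower_bounds_def)
  have "G = loewner_Inf M" if "is_loewner_Inf M G" for G
    unfolding loewner_Inf_def
    using that is_loewner_Inf_unique by (metis the_equality)
  moreover have "H \<in> M \<and> (\<forall>A\<in>M. H \<preceq> A)" if "is_loewner_Inf M H" for H
    using that loewner_Inf_mem[OF assms(1,2,4,5) that]
    by (auto simp: is_loewner_Inf_def loewner_lower_bounds_def)
  ultimately show ?thesis
    using least by blast
qed

end
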